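(* Let $\mathbf{K}$ be an infinite relational structure and let $\mathbf{A}\in\mathrm{Age}(\mathbf{K})$. If $t_\square((\mathbf{A},\mathbf{A}),\mathbf{K})<\infty$, then there is a finite Ramsey basis $\mathcal{B}\subseteq\mathcal{E}_{\mathbf{K}}(\mathbf{A})$.
   Context: Embeddings are injections preserving relations in both directions; $\binom{\mathbf{B}}{\mathbf{A}}$ is the set of copies of $\mathbf{A}$ in $\mathbf{B}$, i.e. images of embeddings of $\mathbf{A}$ into $\mathbf{B}$; $\mathrm{Age}(\mathbf{K})$ is the class of all finite substructures of $\mathbf{K}$. The box Ramsey degree $t_\square((\mathbf{A},\mathbf{A}),\mathbf{K})$ is the smallest integer $t$, if it exists (otherwise it is $\infty$), such that for every $k\in\omega$ and every $c:\binom{\mathbf{K}}{\mathbf{A}}^2\to k$ there is $\mathbf{K}'\in\binom{\mathbf{K}}{\mathbf{K}}$ with $\left|c\left[\binom{\mathbf{K}'}{\mathbf{A}}^2\right]\right|\le t$. $\mathcal{E}_{\mathbf{K}}(\mathbf{A})$ is the set of equivalence relations on $\binom{\mathbf{K}}{\mathbf{A}}$; for $\mathbb{E}\in\mathcal{E}_{\mathbf{K}}(\mathbf{A})$ and $\mathbf{K}'\in\binom{\mathbf{K}}{\mathbf{K}}$, $\mathbb{E}\upharpoonright\mathbf{K}'$ is the restriction of $\mathbb{E}$ to $\binom{\mathbf{K}'}{\mathbf{A}}$. A set $\mathcal{B}\subseteq\mathcal{E}_{\mathbf{K}}(\mathbf{A})$ is a Ramsey basis if for every $\mathbb{E}\in\mathcal{E}_{\mathbf{K}}(\mathbf{A})$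 there are $\tilde{\mathbb{E}}\in\mathcal{B}$ and $\mathbf{K}'\in\binom{\mathbf{K}}{\mathbf{K}}$ such that $\mathbb{E}\upharpoonright\mathbf{K}'=\tilde{\mathbb{E}}\upharpoonright\mathbf{K}'$. *)

theory Defs
  imports Main "HOL-Library.FuncSet" "HOL-Library.Extended_Nat"
begin

text \<open>
  A signature is a partial map assigning an arity to each of its relation symbols. An
  interpretation is a total function; \<open>rel_structure\<close> forces it to be empty outside the signature,
  so that equality of structures is the intended one. The signature and its cardinality are
  arbitrary.
\<close>

datatype ('a, 'l) rel_struct =
  Struct (univ: "'a set") (rel: "'l \<Rightarrow> 'a list set")

definition rel_structure :: "('l \<Rightarrow> nat option) \<Rightarrow> ('a, 'l) rel_struct \<Rightarrow> bool" where
  "rel_structure \<sigma> M \<longleftrightarrow>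
     (\<forall>R. case \<sigma> R of
            None \<Rightarrow> rel M R = {}
          | Some n \<Rightarrow> rel M R \<subseteq> {xs. length xs = n \<and> set xs \<subseteq> univ M})"

definition induced :: "('a, 'l) rel_struct \<Rightarrow> 'a set \<Rightarrow> ('a, 'l) rel_struct" where
  "induced M S = Struct S (\<lambda>R. {xs \<in> rel M R. set xs \<subseteq> S})"

text \<open>
  No arity is needed here: between structures of the same signature, the equivalence is trivial
  for tuples of the wrong length and for symbols outside the signature.
\<close>

definition embedding :: "('a \<Rightarrow> 'b) \<Rightarrow> ('a, 'l) rel_struct \<Rightarrow> ('b, 'l) rel_struct \<Rightarrow> bool" where
  "embedding f A B \<longleftrightarrow>
     f ` univ A \<subseteq> univ B \<and> inj_on f (univ A) \<and>
     (\<forall>R xs. set xs \<subseteq> univ A \<longrightarrow> (xs \<in> rel A R \<longleftrightarrow> map f xs \<in> rel B R))"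

text \<open>The image of an embedding is taken as a substructure of the target, not just as a set.\<close>

definition copies :: "('a, 'l) rel_struct \<Rightarrow> ('b, 'l) rel_struct \<Rightarrow> ('b, 'l) rel_struct set" where
  "copies A B = {induced B (f ` univ A) | f. embedding f A B}"

definition Age :: "('a, 'l) rel_struct \<Rightarrow> ('a, 'l) rel_struct set" where
  "Age K = {induced K S | S. S \<subseteq> univ K \<and> finite S}"

definition box_ramsey_bound ::
  "('a, 'l) rel_struct \<Rightarrow> ('b, 'l) rel_struct \<Rightarrow> nat \<Rightarrow> bool" where
  "box_ramsey_bound A K t \<longleftrightarrow>
     (\<forall>k::nat. \<forall>c \<in> copies A K \<times> copies A K \<rightarrow> {..<k}.
        \<exists>K' \<in> copies K K. card (c ` (copies A K' \<times> copies A K')) \<le> t)"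

text \<open>
  This is $t_\square((\mathbf{A},\mathbf{A}),\mathbf{K})$; the infimum of the empty set of
  extended naturals is \<open>\<infinity>\<close>.
\<close>

definition box_ramsey_degree :: "('a, 'l) rel_struct \<Rightarrow> ('b, 'l) rel_struct \<Rightarrow> enat" where
  "box_ramsey_degree A K = Inf {enat t | t. box_ramsey_bound A K t}"

definition copy_equivs ::
  "('a, 'l) rel_struct \<Rightarrow> ('b, 'l) rel_struct \<Rightarrow> ('b, 'l) rel_struct rel set" where
  "copy_equivs A K = {E. equiv (copies A K) E}"

definition restrict_equiv ::
  "('a, 'l) rel_struct \<Rightarrow> ('b, 'l) rel_struct rel \<Rightarrow> ('b, 'l) rel_struct \<Rightarrow>
     ('b, 'l) rel_struct rel" where
  "restrict_equiv A E K' = E \<inter> (copies A K' \<times> copies A K')"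

definition ramsey_basis ::
  "('a, 'l) rel_struct \<Rightarrow> ('b, 'l) rel_struct \<Rightarrow> ('b, 'l) rel_struct rel set \<Rightarrow> bool" where
  "ramsey_basis A K \<B> \<longleftrightarrow>
     \<B> \<subseteq> copy_equivs A K \<and>
     (\<forall>E \<in> copy_equivs A K. \<exists>E' \<in> \<B>. \<exists>K' \<in> copies K K.
        restrict_equiv A E K' = restrict_equiv A E' K')"

end

theory Submission
  imports Defs
begin

text \<open>
  Take a colouring \<open>c\<close> of the pairs of copies of \<open>A\<close> whose number \<open>m\<close> of unavoidable colours is
  maximal. For an equivalence relation \<open>E\<close>, refine \<open>c\<close> by the indicator of \<open>E\<close>: by maximality of
  \<open>m\<close> some copy \<open>K'\<close> of \<open>K\<close> sees at most \<open>m\<close> refined colours, while it sees at least \<open>m\<close> colours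
  of \<open>c\<close>, so that on \<open>K'\<close> the relation \<open>E\<close> is the preimage under \<open>c\<close> of a set \<open>S\<close> of colours.
  There are finitely many such \<open>S\<close>, but the preimage of \<open>S\<close> need not be an equivalence relation
  outside \<open>K'\<close>. Pulling \<open>c\<close> back along a self-embedding keeps the unavoidable number \<open>m\<close> and can
  only enlarge the family of those \<open>S\<close> whose preimage is an equivalence relation. Choosing \<open>c\<close>
  so that this family is of maximal size, every \<open>S\<close> arising as above already belongs to it.
\<close>

section \<open>Colourings of pairs and a finiteness principle for self-maps\<close>

definition color_rel :: "'x set \<Rightarrow> ('x \<times> 'x \<Rightarrow> nat) \<Rightarrow> nat set \<Rightarrow> 'x rel" where
  "color_rel X c S = {p \<in> X \<times> X. c p \<in> S}"

lemma equiv_pullback: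
  assumes "equiv X E" "f ` X \<subseteq> X"
  shows "equiv X {p \<in> X \<times> X. map_prod f f p \<in> E}"
proof (rule equivI)
  have f: "f x \<in> X" if "x \<in> X" for x
    using assms(2) that by blast
  show "refl_on X {p \<in> X \<times> X. map_prod f f p \<in> E}"
    using equiv_class_self[OF assms(1) f] by (auto simp: refl_on_def)
  show "sym {p \<in> X \<times> X. map_prod f f p \<in> E}"
    using assms(1) by (auto simp: sym_def elim: equivE)
  show "trans {p \<in> X \<times> X. map_prod f f p \<in> E}"
  proof (rule transI)
    fix x y z
    assume "(x, y) \<in> {p \<in> X \<times> X. map_prod f f p \<in> E}" "(y, z) \<in> {p \<in> X \<times> X. map_prod f f p \<in> E}"
    then show "(x, z) \<in> {p \<in> X \<times> X. map_prod f f p \<in> E}"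
      using assms(1) by (auto elim!: equivE dest: transD)
  qed
qed auto

lemma color_rel_pullback:
  assumes "f ` X \<subseteq> X"
  shows "color_rel X (c \<circ> map_prod f f) S = {p \<in> X \<times> X. map_prod f f p \<in> color_rel X c S}"
  using assms by (auto simp: color_rel_def image_subset_iff)

lemma ex_max_nat:
  fixes f :: "'a \<Rightarrow> nat"
  assumes "P x" "\<And>y. P y \<Longrightarrow> f y \<le> b"
  obtains z where "P z" "\<And>y. P y \<Longrightarrow> f y \<le> f z"
proof -
  have "\<forall>y. P y \<longrightarrow> f y < Suc b"
    using assms(2) le_imp_less_Suc by blast
  then show thesis
    using ex_has_greatest_nat[of P x f "Suc b"] assms(1) that by blast
qed

text \<open>Halving sends the refined colours on \<open>Y\<close> onto the colours of
  \<open>c\<close>. If there are no more of the former, halving is injective on them, so the colour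
  \<open>c p\<close> alone decides whether \<open>p\<close> lies in \<open>E\<close>.\<close>

lemma union_of_color_classes:
  fixes c :: "'p \<Rightarrow> nat"
  assumes fin: "finite (c ` Y)"
    and le: "card ((\<lambda>p. 2 * c p + of_bool (p \<in> E)) ` Y) \<le> card (c ` Y)"
  shows "E \<inter> Y = {p \<in> Y. c p \<in> c ` (E \<inter> Y)}"
proof -
  define d where "d = (\<lambda>p. 2 * c p + (of_bool (p \<in> E) :: nat))"
  have "d ` Y \<subseteq> (\<lambda>n. 2 * n) ` c ` Y \<union> (\<lambda>n. 2 * n + 1) ` c ` Y"
    by (auto simp: d_def)
  then have "finite (d ` Y)"
    using fin by (meson finite_Un finite_imageI finite_subset)
  moreover have img: "(\<lambda>n. n div 2) ` d ` Y = c ` Y"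
    by (auto simp: d_def image_image)
  ultimately have inj: "inj_on (\<lambda>n. n div 2) (d ` Y)"
    using le card_image_le[of "d ` Y" "\<lambda>n. n div 2"] by (intro eq_card_imp_inj_on) (auto simp: d_def)
  have "p \<in> E" if "p \<in> Y" "q \<in> E \<inter> Y" "c p = c q" for p q
  proof -
    have "d p = d q"
    proof (rule inj_onD[OF inj])
      show "d p div 2 = d q div 2"
        using that by (simp add: d_def)
    qed (use that in auto)
    with that show ?thesis
      by (auto simp: d_def of_bool_def split: if_splits)
  qed
  then show ?thesis
    by auto
qed

lemma finite_basis_of_self_maps:
  fixes X :: "'x set" and M :: "('x \<Rightarrow> 'x) set"
  assumes "M \<noteq> {}"
    and comp: "\<And>f g. f \<in> M \<Longrightarrow> g \<in> M \<Longrightarrow> f \<circ> g \<in> M"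
    and self: "\<And>f. f \<in> M \<Longrightarrow> f ` X \<subseteq> X"
    and bound: "\<And>(k::nat) c. c \<in> X \<times> X \<rightarrow> {..<k} \<Longrightarrow> \<exists>f\<in>M. card (c ` (f ` X \<times> f ` X)) \<le> t"
  shows "\<exists>\<B>. finite \<B> \<and> \<B> \<subseteq> {E. equiv X E} \<and>
    (\<forall>E. equiv X E \<longrightarrow> (\<exists>E'\<in>\<B>. \<exists>f\<in>M. E \<inter> (f ` X \<times> f ` X) = E' \<inter> (f ` X \<times> f ` X)))"
proof -
  \<comment> \<open>The number \<open>m\<close> is maximised over all palettes, so that refinements
    of \<open>c\<close> with more than \<open>k\<close> colours are covered; \<open>k\<close> is
    then fixed, so that the second maximum is bounded by the size of
    \<open>Pow {..<k}\<close>.\<close>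
  define persistent where "persistent = (\<lambda>(m::nat) (k::nat) c. c \<in> X \<times> X \<rightarrow> {..<k} \<and>
    (\<forall>f\<in>M. m \<le> card (c ` (f ` X \<times> f ` X))))"
  have "persistent 0 1 (\<lambda>_. 0)"
    by (auto simp: persistent_def)
  moreover have "m \<le> t" if "persistent m k c" for m k c
    using that bound[of c k] unfolding persistent_def by (meson order_trans)
  ultimately obtain m where "\<exists>k c. persistent m k c"
    and m_max: "\<And>m'. \<exists>k c. persistent m' k c \<Longrightarrow> m' \<le> m"
    using ex_max_nat[where f = id and P = "\<lambda>m. \<exists>k c. persistent m k c" and b = t and x = 0]
    by (metis id_apply)
  then obtain k c\<^sub>0 where c\<^sub>0: "persistent m k c\<^sub>0"
    by blast
  define equivs where "equivs = (\<lambda>c. {S. S \<subseteq> {..<k} \<and> equiv X (color_rel X c S)})"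
  have equivs_Pow: "equivs c \<subseteq> Pow {..<k}" for c
    by (auto simp: equivs_def)
  have finite_equivs: "finite (equivs c)" for c
    using equivs_Pow finite_subset by blast
  have "card (equivs c) \<le> card (Pow {..<k})" for c
    using equivs_Pow by (intro card_mono) auto
  with c\<^sub>0 obtain c where c: "persistent m k c"
    and c_max: "\<And>c'. persistent m k c' \<Longrightarrow> card (equivs c') \<le> card (equivs c)"
    using ex_max_nat[where P = "persistent m k" and f = "\<lambda>c. card (equivs c)"] by metis
  have equivs_pullback: "equivs (c \<circ> map_prod f f) = equivs c" if f: "f \<in> M" for f
  proof -
    have "persistent m k (c \<circ> map_prod f f)"
      unfolding persistent_def
    proof (intro conjI ballI)
      show "c \<circ> map_prod f f \<in> X \<times> X \<rightarrow> {..<k}"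
        using c self[OF f] by (fastforce simp: persistent_def)
      fix g assume g: "g \<in> M"
      \<comment> \<open>On the image of \<open>g\<close> the pullback shows the colours of
        \<open>c\<close> on the image of \<open>f \<circ> g\<close>, and this map is again in
        \<open>M\<close>.\<close>
      have "(c \<circ> map_prod f f) ` (g ` X \<times> g ` X) = c ` ((f \<circ> g) ` X \<times> (f \<circ> g) ` X)"
        by (simp only: image_comp[symmetric] map_prod_surj_on[OF refl refl])
      then show "m \<le> card ((c \<circ> map_prod f f) ` (g ` X \<times> g ` X))"
        using c comp[OF f g] unfolding persistent_def by metis
    qed
    moreover have "equivs c \<subseteq> equivs (c \<circ> map_prod f f)"
      using self[OF f] equiv_pullback by (auto simp: equivs_def color_rel_pullback)
    ultimately show ?thesis
      using c_max finite_equivs by (metis card_seteq)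
  qed
  have "\<exists>S\<in>equivs c. \<exists>f\<in>M.
      E \<inter> (f ` X \<times> f ` X) = color_rel X c S \<inter> (f ` X \<times> f ` X)" if E: "equiv X E" for E
  proof -
    \<comment> \<open>The pair of \<open>c p\<close> and the truth value of \<open>p \<in> E\<close>
      is coded by one number below \<open>2 * k\<close>.\<close>
    define d where "d = (\<lambda>p. 2 * c p + (of_bool (p \<in> E) :: nat))"
    have "d \<in> X \<times> X \<rightarrow> {..<2 * k}"
    proof
      fix p assume "p \<in> X \<times> X"
      then have "c p < k"
        using c by (auto simp: persistent_def)
      then show "d p \<in> {..<2 * k}"
        by (auto simp: d_def)
    qed
    moreover have "\<not> persistent (Suc m) (2 * k) d"
      using m_max Suc_n_not_le_n by blast
    ultimately obtain f where f: "f \<in> M" and "card (d ` (f ` X \<times> f ` X)) \<le> m"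
      unfolding persistent_def by (auto simp: not_less_eq_eq)
    moreover define Y where "Y = f ` X \<times> f ` X"
    moreover have "m \<le> card (c ` Y)"
      using c f by (auto simp: persistent_def Y_def)
    moreover have Y: "Y \<subseteq> X \<times> X"
      using self[OF f] by (auto simp: Y_def)
    moreover have cY: "c ` Y \<subseteq> {..<k}"
      using c Y by (auto simp: persistent_def)
    ultimately have EY: "E \<inter> Y = {p \<in> Y. c p \<in> c ` (E \<inter> Y)}"
      by (intro union_of_color_classes finite_subset[OF cY]) (auto simp: d_def)
    define S where "S = c ` (E \<inter> Y)"
    have EY: "E \<inter> Y = color_rel X c S \<inter> Y"
      using EY Y unfolding S_def color_rel_def by blast
    \<comment> \<open>\<open>E\<close> and the preimage of \<open>S\<close> agree on
      \<open>Y\<close>, and \<open>f\<close> carries all pairs into \<open>Y\<close>. Hence their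
      pullbacks along \<open>f\<close> agree on all of \<open>X \<times> X\<close>, which puts
      \<open>S\<close> into the family of the pulled-back colouring, and this is the family of
      \<open>c\<close>.\<close>
    have "map_prod f f p \<in> Y" if "p \<in> X \<times> X" for p
      using that by (auto simp: Y_def)
    then have "color_rel X (c \<circ> map_prod f f) S = {p \<in> X \<times> X. map_prod f f p \<in> E}"
      using EY by (subst color_rel_pullback[OF self[OF f]]) blast
    then have "S \<in> equivs (c \<circ> map_prod f f)"
      using equiv_pullback[OF E self[OF f]] cY by (auto simp: equivs_def S_def)
    then show ?thesis
      using EY f equivs_pullback[OF f] by (auto simp: Y_def)
  qed
  then show ?thesis
    using finite_equivs[of c]
    by (intro exI[of _ "color_rel X c ` equivs c"]) (auto simp: equivs_def)
qed

section \<open>Embeddings and induced substructures\<close>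

lemma embedding_id: "embedding id K K"
  by (simp add: embedding_def)

lemma embedding_comp:
  assumes "embedding g A B" "embedding f B C"
  shows "embedding (f \<circ> g) A C"
  unfolding embedding_def
proof (intro conjI allI impI)
  show "(f \<circ> g) ` univ A \<subseteq> univ C"
    using assms by (fastforce simp: embedding_def)
  show "inj_on (f \<circ> g) (univ A)"
    using assms by (meson comp_inj_on embedding_def inj_on_subset)
  fix R xs assume xs: "set xs \<subseteq> univ A"
  then have "set (map g xs) \<subseteq> univ B"
    using assms(1) by (auto simp: embedding_def)
  with xs assms show "xs \<in> rel A R \<longleftrightarrow> map (f \<circ> g) xs \<in> rel C R"
    unfolding embedding_def by (metis map_map)
qed

lemma embedding_cancel:
  assumes "embedding f B C" "embedding (f \<circ> g) A C" "g ` univ A \<subseteq> univ B"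
  shows "embedding g A B"
  unfolding embedding_def
proof (intro conjI allI impI)
  show "inj_on g (univ A)"
    using assms(2) inj_on_imageI2 unfolding embedding_def by blast
  fix R xs assume xs: "set xs \<subseteq> univ A"
  then have "set (map g xs) \<subseteq> univ B"
    using assms(3) by auto
  with xs assms(1,2) show "xs \<in> rel A R \<longleftrightarrow> map g xs \<in> rel B R"
    unfolding embedding_def by (metis map_map)
qed (use assms in auto)

lemma embedding_cong:
  assumes eq: "\<And>x. x \<in> univ A \<Longrightarrow> f x = g x"
  shows "embedding f A B \<longleftrightarrow> embedding g A B"
proof -
  have "map f xs = map g xs" if "set xs \<subseteq> univ A" for xs
    using eq that by (intro map_cong) auto
  moreover have "inj_on f (univ A) \<longleftrightarrow> inj_on g (univ A)"
    using eq by (rule inj_on_cong)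
  moreover have "f ` univ A = g ` univ A"
    using eq by (intro image_cong) auto
  ultimately show ?thesis
    unfolding embedding_def by metis
qed

lemma univ_induced [simp]: "univ (induced K S) = S"
  by (simp add: induced_def)

lemma induced_induced: "T \<subseteq> S \<Longrightarrow> induced (induced K S) T = induced K T"
  by (auto simp: induced_def)

lemma embedding_induced_iff:
  assumes "S \<subseteq> univ K"
  shows "embedding f A (induced K S) \<longleftrightarrow> embedding f A K \<and> f ` univ A \<subseteq> S"
proof -
  have "map f xs \<in> rel (induced K S) R \<longleftrightarrow> map f xs \<in> rel K R"
    if "f ` univ A \<subseteq> S" "set xs \<subseteq> univ A" for xs R
    using that by (auto simp: induced_def)
  then show ?thesis
    using assms unfolding embedding_def by auto
qed

text \<open>The action of \<open>f\<close> on substructures. Relations are always taken from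
  \<open>K\<close>, so \<open>push\<close> respects composition as an equality of functions, as
  closure under composition of the family of induced maps demands.\<close>

definition push :: "('a, 'l) rel_struct \<Rightarrow> ('a \<Rightarrow> 'a) \<Rightarrow> ('a, 'l) rel_struct \<Rightarrow> ('a, 'l) rel_struct"
  where "push K f C = induced K (f ` univ C)"

lemma push_comp: "push K f \<circ> push K g = push K (f \<circ> g)"
  by (auto simp: push_def image_comp)

lemma copies_self: "copies K K = (\<lambda>f. push K f K) ` {f. embedding f K K}"
  by (auto simp: copies_def push_def)

text \<open>An embedding of \<open>A\<close> into the image of \<open>f\<close> factors through
  \<open>f\<close>. This turns the colours seen on a copy of \<open>K\<close> into those seen on an
  image of the set of all copies of \<open>A\<close>.\<close>

lemma copies_push:
  assumes f: "embedding f K K"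
  shows "copies A (push K f K) = push K f ` copies A K"
proof (intro equalityI subsetI)
  have sub: "f ` univ K \<subseteq> univ K"
    using f by (simp add: embedding_def)
  fix C
  {
    assume "C \<in> copies A (push K f K)"
    then obtain g where C: "C = induced K (g ` univ A)"
      and g: "embedding g A K" "g ` univ A \<subseteq> f ` univ K"
      by (auto simp: copies_def push_def embedding_induced_iff[OF sub] induced_induced)
    \<comment> \<open>The factor is obtained by inverting \<open>f\<close> on its image;
      \<open>f \<circ> h\<close> and \<open>g\<close> are compared on \<open>univ A\<close>
      only.\<close>
    define h where "h = inv_into (univ K) f \<circ> g"
    have fh: "(f \<circ> h) x = g x" if "x \<in> univ A" for x
      using g that by (auto simp: h_def f_inv_into_f)
    then have "embedding (f \<circ> h) A K"
      using g(1) embedding_cong by blast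
    moreover have "h ` univ A \<subseteq> univ K"
      using g(2) by (auto simp: h_def intro!: inv_into_into)
    ultimately have "embedding h A K"
      using f embedding_cancel by blast
    moreover have "(f \<circ> h) ` univ A = g ` univ A"
      using fh by (intro image_cong) auto
    then have "C = push K f (induced K (h ` univ A))"
      by (simp add: C push_def image_comp)
    ultimately show "C \<in> push K f ` copies A K"
      by (auto simp: copies_def)
  next
    assume "C \<in> push K f ` copies A K"
    then obtain g where C: "C = induced K ((f \<circ> g) ` univ A)" and g: "embedding g A K"
      by (auto simp: copies_def push_def image_comp)
    moreover have *: "(f \<circ> g) ` univ A \<subseteq> f ` univ K"
      using g by (auto simp: embedding_def)
    ultimately have "embedding (f \<circ> g) A (push K f K)"
      using f by (simp add: push_def embedding_induced_iff[OF sub] embedding_comp)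
    moreover have "C = induced (push K f K) ((f \<circ> g) ` univ A)"
      using * C unfolding push_def by (simp only: induced_induced)
    ultimately show "C \<in> copies A (push K f K)"
      unfolding copies_def by blast
  }
qed

lemma push_copies_subset:
  assumes f: "embedding f K K"
  shows "push K f ` copies A K \<subseteq> copies A K"
proof -
  have "induced K (f ` g ` univ A) \<in> copies A K" if "embedding g A K" for g
    using embedding_comp[OF that f] unfolding copies_def image_comp by blast
  then show ?thesis
    by (auto simp: copies_def push_def)
qed

text \<open>An infimum below \<open>\<infinity>\<close> has a member of the set below
  \<open>\<infinity>\<close>, so the set of bounds is nonempty.\<close>

lemma box_ramsey_degree_finite:
  assumes "box_ramsey_degree A K < \<infinity>"
  obtains t where "box_ramsey_bound A K t"
proof -
  obtain x where "x \<in> {enat t | t. box_ramsey_bound A K t}"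
    using assms unfolding box_ramsey_degree_def Inf_less_iff by blast
  then show thesis
    using that by blast
qed

theorem theorem3p12:
  fixes \<sigma> :: "'l \<Rightarrow> nat option"
    and K A :: "('a, 'l) rel_struct"
  assumes "rel_structure \<sigma> K"
    and "infinite (univ K)"
    and "A \<in> Age K"
    and "box_ramsey_degree A K < \<infinity>"
  shows "\<exists>\<B>. finite \<B> \<and> ramsey_basis A K \<B>"
proof -
  obtain t where t: "box_ramsey_bound A K t"
    using assms(4) by (rule box_ramsey_degree_finite)
  define M where "M = push K ` {f. embedding f K K}"
  have "M \<noteq> {}"
    using embedding_id by (auto simp: M_def)
  moreover have "f \<circ> g \<in> M" if "f \<in> M" "g \<in> M" for f g
    using that embedding_comp unfolding M_def by (force simp: push_comp)
  moreover have "f ` copies A K \<subseteq> copies A K" if "f \<in> M" for f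
    using that push_copies_subset unfolding M_def by blast
  moreover have "\<exists>f\<in>M. card (c ` (f ` copies A K \<times> f ` copies A K)) \<le> t"
    if c: "c \<in> copies A K \<times> copies A K \<rightarrow> {..<k}" for c and k :: nat
  proof -
    obtain K' where "K' \<in> copies K K" "card (c ` (copies A K' \<times> copies A K')) \<le> t"
      using t c unfolding box_ramsey_bound_def by meson
    then show ?thesis
      unfolding M_def copies_self by (auto simp: copies_push)
  qed
  ultimately obtain \<B> where "finite \<B>" "\<B> \<subseteq> {E. equiv (copies A K) E}"
    and \<B>: "\<And>E. equiv (copies A K) E \<Longrightarrow> \<exists>E'\<in>\<B>. \<exists>f\<in>M.
      E \<inter> (f ` copies A K \<times> f ` copies A K) = E' \<inter> (f ` copies A K \<times> f ` copies A K)"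
    using finite_basis_of_self_maps[of M "copies A K" t] by auto
  moreover have "\<exists>E'\<in>\<B>. \<exists>K'\<in>copies K K. restrict_equiv A E K' = restrict_equiv A E' K'"
    if E: "equiv (copies A K) E" for E
  proof -
    obtain E' f where "E' \<in> \<B>" "embedding f K K"
      "restrict_equiv A E (push K f K) = restrict_equiv A E' (push K f K)"
      using \<B>[OF E] unfolding M_def restrict_equiv_def by (auto simp: copies_push)
    then show ?thesis
      unfolding copies_self by blast
  qed
  ultimately show ?thesis
    by (auto simp: ramsey_basis_def copy_equivs_def)
qed

end
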